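(* Let $T$ be a compact torus acting continuously on a connected topological space $X$, such that the action has only finitely many infinitesimal isotropies (i.e. the set $\{\mathfrak{t}_p\mid p\in X\}$ is finite). Then the kernel of the restriction map $r:\mathcal{A}_T(X)\to\mathcal{A}_T(X^T)$ is the $S(\mathfrak{t}^* )$-torsion submodule of $\mathcal{A}_T(X)$.
   Context: $\mathfrak{t}$ is the Lie algebra of $T$; for $p\in X$, $\mathfrak{t}_p\subset\mathfrak{t}$ is the Lie algebra of the isotropy group $T_p$ (the infinitesimal isotropy at $p$). For a subspace $\mathfrak{h}\subset\mathfrak{t}$, $S(\mathfrak{h}^* )$ is the algebra of real polynomial functions on $\mathfrak{h}$. A (polynomial) assignment on a $T$-space $X$ is a map $A$ assigning to each $p\in X$ a polynomial $A(p)\in S(\mathfrak{t}_p^* )$ such that for every (connected) subtorus $H\subset T$ with Lie algebra $\mathfrak{h}$, the map $p\mapsto A(p)|_{\mathfrak{h}}$ is locally constant on the fixed point set $X^H$. $\mathcal{A}_T(X)$ denotes the set of all assignments, an $S(\mathfrak{t}^* )$-algebra with pointwise operations, $(fA)(p)=f|_{\mathfrak{t}_p}A(p)$; in particular $\mathcal{A}_T(\emptyset)=\{0\}$. For a $T$-invariant subspace $Y\subset X$, the restriction map $\mathcal{A}_T(X)\to\mathcal{A}_T(Y)$ sends $A$ to $A|_Y$. $X^T$ is the set of $T$-fixed points. *)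

theory Defs
  imports
    "HOL-Analysis.Analysis"
    "HOL-Algebra.AbelCoset"
    "HOL-Algebra.Module"
begin

section \<open>Tori and their Lie algebras\<close>

text \<open>The ambient group is an abelian topological group, written additively and given as a type
  \<open>'g\<close>.  A subset is a torus if it is a subgroup that, with the subspace topology, is isomorphic
  as a topological group to \<open>U(1)\<^sup>n\<close> for some \<open>n \<ge> 0\<close>.\<close>

definition is_torus :: "'g::topological_ab_group_add set \<Rightarrow> bool" where
  "is_torus H \<longleftrightarrow>
     0 \<in> H \<and> (\<forall>g\<in>H. \<forall>h\<in>H. g + h \<in> H) \<and> (\<forall>g\<in>H. - g \<in> H) \<and>
     (\<exists>(n::nat) (\<phi> :: 'g \<Rightarrow> nat \<Rightarrow> complex).
        homeomorphic_map (top_of_set H) (product_topology (\<lambda>_. top_of_set (sphere 0 1)) {..<n}) \<phi> \<and>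
        (\<forall>g\<in>H. \<forall>h\<in>H. \<forall>i<n. \<phi> (g + h) i = \<phi> g i * \<phi> h i))"

text \<open>The Lie algebra of \<open>'g\<close> is the real vector space of its continuous one-parameter subgroups;
  \<open>one_param \<xi> s\<close> is what is usually written \<open>exp (s \<xi>)\<close>.\<close>

typedef (overloaded) 'g lie_alg =
  "{\<gamma> :: real \<Rightarrow> 'g::topological_ab_group_add.
      continuous_on UNIV \<gamma> \<and> (\<forall>s t. \<gamma> (s + t) = \<gamma> s + \<gamma> t)}"
  morphisms one_param Abs_lie_alg
  by (rule exI[of _ "\<lambda>_. 0"]) simp

setup_lifting type_definition_lie_alg

instantiation lie_alg :: (topological_ab_group_add) real_vector
begin

lift_definition zero_lie_alg :: "'a lie_alg" is "\<lambda>_. 0"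
  by simp

lift_definition plus_lie_alg :: "'a lie_alg \<Rightarrow> 'a lie_alg \<Rightarrow> 'a lie_alg" is "\<lambda>\<gamma> \<delta> s. \<gamma> s + \<delta> s"
  by (auto intro: continuous_on_add simp: algebra_simps)

lift_definition uminus_lie_alg :: "'a lie_alg \<Rightarrow> 'a lie_alg" is "\<lambda>\<gamma> s. - \<gamma> s"
  by (auto intro: continuous_on_minus)

lift_definition minus_lie_alg :: "'a lie_alg \<Rightarrow> 'a lie_alg \<Rightarrow> 'a lie_alg" is "\<lambda>\<gamma> \<delta> s. \<gamma> s - \<delta> s"
  by (auto intro: continuous_on_diff simp: algebra_simps)

lift_definition scaleR_lie_alg :: "real \<Rightarrow> 'a lie_alg \<Rightarrow> 'a lie_alg" is "\<lambda>c \<gamma> s. \<gamma> (c * s)"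
proof -
  fix c :: real and \<gamma> :: "real \<Rightarrow> 'a"
  assume \<gamma>: "continuous_on UNIV \<gamma> \<and> (\<forall>s t. \<gamma> (s + t) = \<gamma> s + \<gamma> t)"
  have "continuous_on UNIV (\<lambda>s. c * s)"
    by (intro continuous_intros)
  with \<gamma> have "continuous_on UNIV (\<lambda>s. \<gamma> (c * s))"
    by (auto intro: continuous_on_compose2[of UNIV \<gamma>])
  with \<gamma> show "continuous_on UNIV (\<lambda>s. \<gamma> (c * s)) \<and>
      (\<forall>s t. \<gamma> (c * (s + t)) = \<gamma> (c * s) + \<gamma> (c * t))"
    by (simp add: distrib_left)
qed

instance
  by standard (transfer; force simp: algebra_simps)+

end

definition lie_of :: "'g::topological_ab_group_add set \<Rightarrow> 'g lie_alg set" where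
  "lie_of H = {\<xi>. \<forall>s. one_param \<xi> s \<in> H}"


section \<open>Polynomial functions\<close>

text \<open>\<open>poly_funs V\<close> is the underlying set of \<open>S(V\<^sup>*)\<close> for a subspace \<open>V\<close>: the algebra of functions
  on \<open>V\<close> generated by the constants and the linear functionals on \<open>V\<close>.  Its elements are
  extensional, i.e. \<open>undefined\<close> off \<open>V\<close>, so that equality is equality of functions on \<open>V\<close>.\<close>

inductive_set poly_funs :: "'a::real_vector set \<Rightarrow> ('a \<Rightarrow> real) set" for V where
  const: "(\<lambda>\<xi>\<in>V. c) \<in> poly_funs V"
| functional: "\<lbrakk>\<forall>\<xi>\<in>V. \<forall>\<eta>\<in>V. l (\<xi> + \<eta>) = l \<xi> + l \<eta>; \<forall>c. \<forall>\<xi>\<in>V. l (c *\<^sub>R \<xi>) = c * l \<xi>\<rbrakk>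
    \<Longrightarrow> (\<lambda>\<xi>\<in>V. l \<xi>) \<in> poly_funs V"
| add: "\<lbrakk>f \<in> poly_funs V; g \<in> poly_funs V\<rbrakk> \<Longrightarrow> (\<lambda>\<xi>\<in>V. f \<xi> + g \<xi>) \<in> poly_funs V"
| mult: "\<lbrakk>f \<in> poly_funs V; g \<in> poly_funs V\<rbrakk> \<Longrightarrow> (\<lambda>\<xi>\<in>V. f \<xi> * g \<xi>) \<in> poly_funs V"

definition poly_ring :: "'a::real_vector set \<Rightarrow> ('a \<Rightarrow> real) ring" where
  "poly_ring V =
     \<lparr>carrier = poly_funs V,
      mult = (\<lambda>f g. \<lambda>\<xi>\<in>V. f \<xi> * g \<xi>),
      one = (\<lambda>\<xi>\<in>V. 1),
      zero = (\<lambda>\<xi>\<in>V. 0),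
      add = (\<lambda>f g. \<lambda>\<xi>\<in>V. f \<xi> + g \<xi>)\<rparr>"


section \<open>Continuous actions\<close>

definition continuous_action ::
    "('g::topological_ab_group_add \<Rightarrow> 'x \<Rightarrow> 'x) \<Rightarrow> 'x topology \<Rightarrow> bool" where
  "continuous_action act X \<longleftrightarrow>
     continuous_map (prod_topology euclidean X) X (\<lambda>(g, p). act g p) \<and>
     (\<forall>p\<in>topspace X. act 0 p = p) \<and>
     (\<forall>g h. \<forall>p\<in>topspace X. act (g + h) p = act g (act h p))"

definition isotropy_alg ::
    "('g::topological_ab_group_add \<Rightarrow> 'x \<Rightarrow> 'x) \<Rightarrow> 'x \<Rightarrow> 'g lie_alg set" where
  "isotropy_alg act p = lie_of {g. act g p = p}"

definition fixed_points :: "('g \<Rightarrow> 'x \<Rightarrow> 'x) \<Rightarrow> 'x topology \<Rightarrow> 'g set \<Rightarrow> 'x set" where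
  "fixed_points act X H = {p \<in> topspace X. \<forall>g\<in>H. act g p = p}"


section \<open>Assignments\<close>

definition locally_constant_map :: "'x topology \<Rightarrow> ('x \<Rightarrow> 'b) \<Rightarrow> bool" where
  "locally_constant_map Y f \<longleftrightarrow>
     (\<forall>p\<in>topspace Y. \<exists>U. openin Y U \<and> p \<in> U \<and> (\<forall>q\<in>U. f q = f p))"

definition assignments ::
    "('g::topological_ab_group_add \<Rightarrow> 'x \<Rightarrow> 'x) \<Rightarrow> 'x topology \<Rightarrow> ('x \<Rightarrow> 'g lie_alg \<Rightarrow> real) set" where
  "assignments act X =
     {A \<in> (\<Pi>\<^sub>E p\<in>topspace X. poly_funs (isotropy_alg act p)).
        \<forall>H. is_torus H \<longrightarrow>
          locally_constant_map (subtopology X (fixed_points act X H))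
            (\<lambda>p. restrict (A p) (lie_of H))}"

definition assignment_algebra ::
    "('g::topological_ab_group_add \<Rightarrow> 'x \<Rightarrow> 'x) \<Rightarrow> 'x topology
      \<Rightarrow> ('g lie_alg \<Rightarrow> real, 'x \<Rightarrow> 'g lie_alg \<Rightarrow> real) module" where
  "assignment_algebra act X =
     \<lparr>carrier = assignments act X,
      mult = (\<lambda>A B. \<lambda>p\<in>topspace X. \<lambda>\<xi>\<in>isotropy_alg act p. A p \<xi> * B p \<xi>),
      one = (\<lambda>p\<in>topspace X. \<lambda>\<xi>\<in>isotropy_alg act p. 1),
      zero = (\<lambda>p\<in>topspace X. \<lambda>\<xi>\<in>isotropy_alg act p. 0),
      add = (\<lambda>A B. \<lambda>p\<in>topspace X. \<lambda>\<xi>\<in>isotropy_alg act p. A p \<xi> + B p \<xi>),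
      smult = (\<lambda>f A. \<lambda>p\<in>topspace X. \<lambda>\<xi>\<in>isotropy_alg act p. f \<xi> * A p \<xi>)\<rparr>"

definition restriction_map :: "'x set \<Rightarrow> ('x \<Rightarrow> 'b) \<Rightarrow> 'x \<Rightarrow> 'b" where
  "restriction_map Y A = restrict A Y"

text \<open>Only used for \<open>R = S(V\<^sup>*)\<close>, an integral domain, so that \<open>a\<close> need only be nonzero.\<close>

definition torsion_submodule ::
    "('r, 'm) ring_scheme \<Rightarrow> ('r, 'a, 'n) module_scheme \<Rightarrow> 'a set" where
  "torsion_submodule R M =
     {x \<in> carrier M. \<exists>a \<in> carrier R. a \<noteq> \<zero>\<^bsub>R\<^esub> \<and> a \<odot>\<^bsub>M\<^esub> x = \<zero>\<^bsub>M\<^esub>}"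


section \<open>The algebraic structures\<close>

lemma poly_funs_extensional: "f \<in> poly_funs V \<Longrightarrow> f \<in> extensional V"
  by (induction rule: poly_funs.induct) (rule restrict_extensional)+

lemma poly_funs_ext: "f \<in> poly_funs V \<Longrightarrow> (\<lambda>\<xi>\<in>V. f \<xi>) = f"
  by (simp add: poly_funs_extensional extensional_restrict)

lemma poly_funs_uminus:
  assumes "f \<in> poly_funs V"
  shows "(\<lambda>\<xi>\<in>V. - f \<xi>) \<in> poly_funs V"
proof -
  have "(\<lambda>\<xi>\<in>V. (\<lambda>\<xi>\<in>V. - 1) \<xi> * f \<xi>) \<in> poly_funs V"
    by (intro poly_funs.mult poly_funs.const assms)
  also have "(\<lambda>\<xi>\<in>V. (\<lambda>\<xi>\<in>V. - 1) \<xi> * f \<xi>) = (\<lambda>\<xi>\<in>V. - f \<xi>)"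
    by (auto simp: restrict_def)
  finally show ?thesis .
qed

lemma poly_funs_restrict:
  assumes "f \<in> poly_funs V" "W \<subseteq> V"
  shows "restrict f W \<in> poly_funs W"
proof -
  have VW: "V \<inter> W = W" using assms(2) by blast
  show ?thesis
    using assms(1)
  proof induction
    case (const c)
    have "restrict (\<lambda>\<xi>\<in>V. c) W \<in> poly_funs W"
      using poly_funs.const[of c W] by (simp add: VW)
    then show ?case .
  next
    case (functional l)
    then have "(\<lambda>\<xi>\<in>W. l \<xi>) \<in> poly_funs W"
      using assms(2) by (intro poly_funs.functional) blast+
    then have "restrict (\<lambda>\<xi>\<in>V. l \<xi>) W \<in> poly_funs W"
      by (simp add: VW)
    then show ?case .
  next
    case (add f g)
    have "(\<lambda>\<xi>\<in>W. restrict f W \<xi> + restrict g W \<xi>) \<in> poly_funs W"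
      using add.IH by (rule poly_funs.add)
    also have "(\<lambda>\<xi>\<in>W. restrict f W \<xi> + restrict g W \<xi>) = restrict (\<lambda>\<xi>\<in>V. f \<xi> + g \<xi>) W"
      using assms(2) by (auto simp: fun_eq_iff)
    finally show ?case .
  next
    case (mult f g)
    have "(\<lambda>\<xi>\<in>W. restrict f W \<xi> * restrict g W \<xi>) \<in> poly_funs W"
      using mult.IH by (rule poly_funs.mult)
    also have "(\<lambda>\<xi>\<in>W. restrict f W \<xi> * restrict g W \<xi>) = restrict (\<lambda>\<xi>\<in>V. f \<xi> * g \<xi>) W"
      using assms(2) by (auto simp: fun_eq_iff)
    finally show ?case .
  qed
qed

lemma poly_ring_cring: "cring (poly_ring V)"
proof (intro cringI abelian_groupI comm_monoidI)
  fix f assume "f \<in> carrier (poly_ring V)"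
  then show "\<exists>g\<in>carrier (poly_ring V). g \<oplus>\<^bsub>poly_ring V\<^esub> f = \<zero>\<^bsub>poly_ring V\<^esub>"
    by (intro bexI[of _ "\<lambda>\<xi>\<in>V. - f \<xi>"]) (auto simp: poly_ring_def poly_funs_uminus)
qed (auto simp: poly_ring_def poly_funs.intros poly_funs_ext algebra_simps cong: restrict_cong)

lemma subspace_isotropy_alg:
  assumes "continuous_action act X" "p \<in> topspace X"
  shows "subspace (isotropy_alg act p)"
proof (rule subspaceI)
  show "0 \<in> isotropy_alg act p"
    using assms by (simp add: isotropy_alg_def lie_of_def zero_lie_alg.rep_eq continuous_action_def)
  show "\<xi> + \<eta> \<in> isotropy_alg act p"
    if "\<xi> \<in> isotropy_alg act p" "\<eta> \<in> isotropy_alg act p" for \<xi> \<eta>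
    using assms that by (simp add: isotropy_alg_def lie_of_def plus_lie_alg.rep_eq continuous_action_def)
  show "c *\<^sub>R \<xi> \<in> isotropy_alg act p" if "\<xi> \<in> isotropy_alg act p" for c \<xi>
    using that by (simp add: isotropy_alg_def lie_of_def scaleR_lie_alg.rep_eq)
qed

lemma lie_of_subset_isotropy: "p \<in> fixed_points act X H \<Longrightarrow> lie_of H \<subseteq> isotropy_alg act p"
  by (auto simp: fixed_points_def isotropy_alg_def lie_of_def)

lemma topspace_fixed_subtopology:
  "topspace (subtopology X (fixed_points act X H)) = fixed_points act X H"
  by (auto simp: fixed_points_def)

lemma assignments_poly: "A \<in> assignments act X \<Longrightarrow> p \<in> topspace X \<Longrightarrow> A p \<in> poly_funs (isotropy_alg act p)"
  by (auto simp: assignments_def)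

lemma assignments_locally_constant:
  assumes "A \<in> assignments act X" "is_torus H" "p \<in> fixed_points act X H"
  shows "\<exists>U. openin (subtopology X (fixed_points act X H)) U \<and> p \<in> U \<and>
           (\<forall>q\<in>U. restrict (A q) (lie_of H) = restrict (A p) (lie_of H))"
proof -
  have "locally_constant_map (subtopology X (fixed_points act X H)) (\<lambda>p. restrict (A p) (lie_of H))"
    using assms(1,2) by (simp add: assignments_def)
  then show ?thesis
    unfolding locally_constant_map_def topspace_fixed_subtopology using assms(3) by (rule bspec)
qed

lemma assignments_pointwise:
  fixes F :: "'g::topological_ab_group_add lie_alg \<Rightarrow> real \<Rightarrow> real \<Rightarrow> real"
  assumes A: "A \<in> assignments act X" and B: "B \<in> assignments act X"
    and poly: "\<And>p. p \<in> topspace X \<Longrightarrow>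
      (\<lambda>\<xi>\<in>isotropy_alg act p. F \<xi> (A p \<xi>) (B p \<xi>)) \<in> poly_funs (isotropy_alg act p)"
  shows "(\<lambda>p\<in>topspace X. \<lambda>\<xi>\<in>isotropy_alg act p. F \<xi> (A p \<xi>) (B p \<xi>)) \<in> assignments act X"
    (is "?C \<in> _")
proof -
  have "locally_constant_map (subtopology X (fixed_points act X H)) (\<lambda>p. restrict (?C p) (lie_of H))"
    if H: "is_torus H" for H
    unfolding locally_constant_map_def topspace_fixed_subtopology
  proof
    let ?Y = "subtopology X (fixed_points act X H)"
    fix p assume p: "p \<in> fixed_points act X H"
    from assignments_locally_constant[OF A H p] obtain U where U: "openin ?Y U" "p \<in> U"
      "\<And>q. q \<in> U \<Longrightarrow> restrict (A q) (lie_of H) = restrict (A p) (lie_of H)"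
      by blast
    from assignments_locally_constant[OF B H p] obtain W where W: "openin ?Y W" "p \<in> W"
      "\<And>q. q \<in> W \<Longrightarrow> restrict (B q) (lie_of H) = restrict (B p) (lie_of H)"
      by metis
    have "restrict (?C q) (lie_of H) = restrict (?C p) (lie_of H)" if q: "q \<in> U \<inter> W" for q
    proof (rule restrict_ext)
      fix \<xi> assume \<xi>: "\<xi> \<in> lie_of H"
      have qf: "q \<in> fixed_points act X H"
        using q openin_subset[OF U(1)] by (auto simp: topspace_fixed_subtopology)
      have "restrict (A q) (lie_of H) \<xi> = restrict (A p) (lie_of H) \<xi>"
        "restrict (B q) (lie_of H) \<xi> = restrict (B p) (lie_of H) \<xi>"
        using fun_cong[OF U(3)[OF IntD1[OF q]]] fun_cong[OF W(3)[OF IntD2[OF q]]] .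
      then have eq: "A q \<xi> = A p \<xi>" "B q \<xi> = B p \<xi>"
        using \<xi> by simp_all
      have "p \<in> topspace X" "q \<in> topspace X" "\<xi> \<in> isotropy_alg act p" "\<xi> \<in> isotropy_alg act q"
        using lie_of_subset_isotropy[OF p] lie_of_subset_isotropy[OF qf] p qf \<xi>
        by (auto simp: fixed_points_def)
      then show "?C q \<xi> = ?C p \<xi>"
        by (simp add: eq)
    qed
    then have "\<forall>q\<in>U \<inter> W. restrict (?C q) (lie_of H) = restrict (?C p) (lie_of H)"
      by (intro ballI)
    with openin_Int[OF U(1) W(1)] IntI[OF U(2) W(2)]
    show "\<exists>U. openin ?Y U \<and> p \<in> U \<and>
        (\<forall>q\<in>U. restrict (?C q) (lie_of H) = restrict (?C p) (lie_of H))"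
      by (intro exI[of _ "U \<inter> W"] conjI)
  qed
  moreover have "?C \<in> (\<Pi>\<^sub>E p\<in>topspace X. poly_funs (isotropy_alg act p))"
    using poly by (subst restrict_PiE_iff) blast
  ultimately show ?thesis
    unfolding assignments_def by blast
qed

lemma assignments_const:
  "(\<lambda>p\<in>topspace X. \<lambda>\<xi>\<in>isotropy_alg act p. c) \<in> assignments act X" (is "?C \<in> _")
proof -
  have "locally_constant_map (subtopology X (fixed_points act X H)) (\<lambda>p. restrict (?C p) (lie_of H))"
    for H
  proof -
    have "restrict (?C p) (lie_of H) = (\<lambda>\<xi>\<in>lie_of H. c)" if "p \<in> fixed_points act X H" for p
      using lie_of_subset_isotropy[OF that] that by (auto simp: restrict_def fixed_points_def fun_eq_iff)
    then show ?thesis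
      unfolding locally_constant_map_def topspace_fixed_subtopology
      by (metis openin_topspace topspace_fixed_subtopology)
  qed
  then show ?thesis
    by (auto simp: assignments_def poly_funs.const)
qed

lemma assignments_ext:
  assumes "A \<in> assignments act X"
  shows "(\<lambda>p\<in>topspace X. \<lambda>\<xi>\<in>isotropy_alg act p. A p \<xi>) = A"
proof -
  have "A \<in> extensional (topspace X)"
    using assms by (simp add: assignments_def PiE_def)
  then have "A = (\<lambda>p\<in>topspace X. A p)"
    by (simp add: extensional_restrict)
  then show ?thesis
    using poly_funs_ext[OF assignments_poly[OF assms]] by (metis (no_types, lifting) restrict_ext)
qed

lemma assignment_algebra_cring: "cring (assignment_algebra act X)"
proof (intro cringI abelian_groupI comm_monoidI)
  fix A assume "A \<in> carrier (assignment_algebra act X)"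
  then have A: "A \<in> assignments act X" by (simp add: assignment_algebra_def)
  then have "(\<lambda>p\<in>topspace X. \<lambda>\<xi>\<in>isotropy_alg act p. - A p \<xi>) \<in> assignments act X"
    by (intro assignments_pointwise[OF A A, where F = "\<lambda>_ a _. - a"])
       (blast intro: poly_funs_uminus assignments_poly)
  then show "\<exists>B\<in>carrier (assignment_algebra act X).
      B \<oplus>\<^bsub>assignment_algebra act X\<^esub> A = \<zero>\<^bsub>assignment_algebra act X\<^esub>"
    by (intro bexI[of _ "\<lambda>p\<in>topspace X. \<lambda>\<xi>\<in>isotropy_alg act p. - A p \<xi>"])
       (auto simp: assignment_algebra_def restrict_def fun_eq_iff)
next
  fix A B assume AB: "A \<in> carrier (assignment_algebra act X)" "B \<in> carrier (assignment_algebra act X)"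
  then have AB': "A \<in> assignments act X" "B \<in> assignments act X"
    by (simp_all add: assignment_algebra_def)
  show "A \<oplus>\<^bsub>assignment_algebra act X\<^esub> B \<in> carrier (assignment_algebra act X)"
    using assignments_pointwise[OF AB', of "\<lambda>_. (+)"] AB'
    by (simp add: assignment_algebra_def poly_funs.add assignments_poly)
  show "A \<otimes>\<^bsub>assignment_algebra act X\<^esub> B \<in> carrier (assignment_algebra act X)"
    using assignments_pointwise[OF AB', of "\<lambda>_. (*)"] AB'
    by (simp add: assignment_algebra_def poly_funs.mult assignments_poly)
qed (auto simp: assignment_algebra_def assignments_const assignments_ext algebra_simps
       cong: restrict_cong)

proposition assignment_algebra:
  fixes act :: "'g::topological_ab_group_add \<Rightarrow> 'x \<Rightarrow> 'x"
  assumes "continuous_action act X"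
  shows "algebra (poly_ring UNIV) (assignment_algebra act X)"
proof (rule algebraI)
  fix f :: "'g lie_alg \<Rightarrow> real" and A :: "'x \<Rightarrow> 'g lie_alg \<Rightarrow> real"
  assume "f \<in> carrier (poly_ring UNIV)" "A \<in> carrier (assignment_algebra act X)"
  then have f: "f \<in> poly_funs UNIV" and A: "A \<in> assignments act X"
    by (simp_all add: poly_ring_def assignment_algebra_def)
  have "(\<lambda>\<xi>\<in>isotropy_alg act p. f \<xi> * A p \<xi>) \<in> poly_funs (isotropy_alg act p)"
    if p: "p \<in> topspace X" for p
    using poly_funs.mult[OF poly_funs_restrict[OF f subset_UNIV]
        assignments_poly[OF A p]]
    by (simp cong: restrict_cong)
  then show "f \<odot>\<^bsub>assignment_algebra act X\<^esub> A \<in> carrier (assignment_algebra act X)"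
    using assignments_pointwise[OF A A, of "\<lambda>\<xi> a _. f \<xi> * a"]
    by (simp add: assignment_algebra_def)
qed (auto simp: poly_ring_cring assignment_algebra_cring,
     auto simp: assignment_algebra_def poly_ring_def assignments_ext algebra_simps cong: restrict_cong)

end

theory Submission
  imports Defs "HOL-Computational_Algebra.Polynomial"
begin

text \<open>
  Both inclusions are decided pointwise, by comparing \<open>\<tt>\<^sub>p\<close> with \<open>\<tt>\<close>.  Every element of a torus
  lies on a one-parameter subgroup (\<open>torus_one_param\<close>), so \<open>\<tt>\<^sub>p = \<tt>\<close> holds exactly at the points
  \<open>p\<close> fixed by the whole torus (\<open>isotropy_alg_eq_UNIV_iff\<close>).

  Suppose that \<open>f A = 0\<close> with \<open>f \<noteq> 0\<close>.  At a fixed point, \<open>f\<close> and \<open>A p\<close> are polynomial functions on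
  the same space \<open>\<tt>\<close>.  Such functions form an integral domain (\<open>poly_funs_no_zero_divisors\<close>), so
  \<open>A p = 0\<close>.

  Conversely, suppose that \<open>A\<close> vanishes at the fixed points.  At all other points \<open>\<tt>\<^sub>p\<close> is one of
  finitely many proper subspaces of \<open>\<tt>\<close>.  Each of these is annihilated by some nonzero linear
  functional, and the product \<open>f\<close> of these functionals is a nonzero polynomial that vanishes on all
  of them (\<open>finite_proper_subspaces_annihilated\<close>).  Then \<open>f A = 0\<close>: at a fixed point because
  \<open>A p = 0\<close>, and elsewhere because \<open>f\<close> restricts to \<open>0\<close> on \<open>\<tt>\<^sub>p\<close>.
\<close>

section \<open>Polynomial functions on a real vector space\<close>

lemma poly_funs_along_line:
  assumes "f \<in> poly_funs V" and V: "subspace V" "x \<in> V" "d \<in> V"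
  shows "\<exists>P. \<forall>s. f (x + s *\<^sub>R d) = poly P s"
proof -
  have line: "x + s *\<^sub>R d \<in> V" for s
    using V by (simp add: subspace_add subspace_scale)
  show ?thesis
    using assms(1)
  proof induction
    case (const c)
    show ?case
      by (rule exI[of _ "[:c:]"]) (simp add: line)
  next
    case (functional l)
    have "l (x + s *\<^sub>R d) = l x + s * l d" for s
      using functional V by (simp add: subspace_scale)
    then show ?case
      by (intro exI[of _ "[:l x, l d:]"]) (simp add: line)
  next
    case (add f g)
    then obtain P Q where "\<forall>s. f (x + s *\<^sub>R d) = poly P s" "\<forall>s. g (x + s *\<^sub>R d) = poly Q s"
      by blast
    then show ?case
      by (intro exI[of _ "P + Q"]) (simp add: line)
  next
    case (mult f g)
    then obtain P Q where "\<forall>s. f (x + s *\<^sub>R d) = poly P s" "\<forall>s. g (x + s *\<^sub>R d) = poly Q s"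
      by blast
    then show ?case
      by (intro exI[of _ "P * Q"]) (simp add: line)
  qed
qed

text \<open>If \<open>f\<close> is nonzero at \<open>x\<close> and \<open>g\<close> is nonzero at \<open>y\<close>, then on the line through \<open>x\<close> and \<open>y\<close> both
  are nonzero polynomials in one variable, so their product is nonzero somewhere on that line.  The
  argument works in any dimension.\<close>

lemma poly_funs_no_zero_divisors:
  assumes f: "f \<in> poly_funs V" "x \<in> V" "f x \<noteq> 0"
    and g: "g \<in> poly_funs V" "y \<in> V" "g y \<noteq> 0"
    and V: "subspace V"
  obtains z where "z \<in> V" "f z * g z \<noteq> 0"
proof -
  have d: "y - x \<in> V"
    using V f(2) g(2) by (simp add: subspace_diff)
  obtain P where P: "\<And>s. f (x + s *\<^sub>R (y - x)) = poly P s"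
    using poly_funs_along_line[OF f(1) V f(2) d] by blast
  obtain Q where Q: "\<And>s. g (x + s *\<^sub>R (y - x)) = poly Q s"
    using poly_funs_along_line[OF g(1) V f(2) d] by blast
  have "poly P 0 \<noteq> 0" "poly Q 1 \<noteq> 0"
    using f(3) g(3) P[of 0] Q[of 1] by simp_all
  then have "P * Q \<noteq> 0"
    by auto
  then obtain s where "poly (P * Q) s \<noteq> 0"
    using poly_all_0_iff_0 by blast
  then have "f (x + s *\<^sub>R (y - x)) * g (x + s *\<^sub>R (y - x)) \<noteq> 0"
    by (simp add: P Q)
  moreover have "x + s *\<^sub>R (y - x) \<in> V"
    using V f(2) d by (simp add: subspace_add subspace_scale)
  ultimately show thesis
    using that by blast
qed

text \<open>A Hamel basis of \<open>W\<close> stays independent when \<open>v\<close> is added, so a functional may be prescribed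
  freely on it.\<close>

lemma proper_subspace_annihilated:
  fixes W :: "'a::real_vector set"
  assumes W: "subspace W" and "v \<notin> W"
  obtains l :: "'a \<Rightarrow> real" where "linear l" "\<And>w. w \<in> W \<Longrightarrow> l w = 0" "l v = 1"
proof -
  obtain B where B: "B \<subseteq> W" "independent B" "span B = W"
    using basis_exists[of W] W by (metis span_minimal subset_antisym)
  then have v: "v \<notin> span B"
    using \<open>v \<notin> W\<close> by simp
  then have "v \<notin> B"
    using span_base by blast
  have "independent (insert v B)"
    using B(2) v by (rule independent_insertI[rotated])
  then obtain l :: "'a \<Rightarrow> real"
    where l: "linear l" "\<And>w. w \<in> insert v B \<Longrightarrow> l w = (if w = v then 1 else 0)"
    using linear_independent_extend[of "insert v B" "\<lambda>w. if w = v then 1 else 0"] by blast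
  have "l w = 0" if "w \<in> W" for w
  proof (rule linear_eq_0_on_span[OF l(1)])
    show "l b = 0" if "b \<in> B" for b
      using l(2)[of b] that \<open>v \<notin> B\<close> by auto
    show "w \<in> span B"
      using that B(3) by simp
  qed
  with l show thesis
    using that by simp
qed

text \<open>The induction multiplies the polynomial for \<open>F\<close> by a functional that vanishes on the new
  subspace; the absence of zero divisors keeps the product nonzero.\<close>

lemma finite_proper_subspaces_annihilated:
  fixes F :: "'a::real_vector set set"
  assumes "finite F" and "\<And>W. W \<in> F \<Longrightarrow> subspace W \<and> W \<noteq> UNIV"
  shows "\<exists>f\<in>poly_funs UNIV. (\<exists>x. f x \<noteq> 0) \<and> (\<forall>W\<in>F. \<forall>w\<in>W. f w = 0)"
  using assms
proof (induction F rule: finite_induct)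
  case empty
  show ?case
    using poly_funs.const[of 1 "UNIV :: 'a set"]
    by (intro bexI[of _ "\<lambda>_. 1"]) (simp_all add: restrict_def)
next
  case (insert W F)
  have "\<exists>f\<in>poly_funs UNIV. (\<exists>x. f x \<noteq> 0) \<and> (\<forall>W\<in>F. \<forall>w\<in>W. f w = 0)"
    by (rule insert.IH) (rule insert.prems, rule insertI2)
  then obtain f x where f: "f \<in> poly_funs UNIV" "f x \<noteq> 0" "\<forall>W\<in>F. \<forall>w\<in>W. f w = 0"
    by blast
  have W: "subspace W" "W \<noteq> UNIV"
    using insert.prems[OF insertI1] by blast+
  then obtain v where v: "v \<notin> W"
    by blast
  obtain l :: "'a \<Rightarrow> real" where l: "linear l" "\<And>w. w \<in> W \<Longrightarrow> l w = 0" "l v = 1"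
    using proper_subspace_annihilated[OF W(1) v] by blast
  have lv: "l v \<noteq> 0"
    using l(3) by simp
  have l_poly: "l \<in> poly_funs UNIV"
    using poly_funs.functional[of UNIV l] l(1) by (simp add: restrict_def linear_add linear_scale)
  obtain z where "f z * l z \<noteq> 0"
    using poly_funs_no_zero_divisors[OF f(1) UNIV_I f(2) l_poly UNIV_I lv subspace_UNIV]
    by blast
  moreover have "(\<lambda>w. f w * l w) \<in> poly_funs UNIV"
    using poly_funs.mult[OF f(1) l_poly] by (simp add: restrict_def)
  ultimately show ?case
    using f(3) l(2) by (intro bexI[of _ "\<lambda>w. f w * l w"]) auto
qed

section \<open>One-parameter subgroups of a torus\<close>

text \<open>In the coordinates of \<open>U(1)\<^sup>n\<close>, the element \<open>(cis \<theta>\<^sub>1, \<dots>, cis \<theta>\<^sub>n)\<close> is the value at \<open>s = 1\<close> of the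
  one-parameter subgroup \<open>s \<mapsto> (cis (s \<theta>\<^sub>1), \<dots>, cis (s \<theta>\<^sub>n))\<close>.\<close>

lemma torus_one_param:
  fixes g :: "'g::topological_ab_group_add"
  assumes "is_torus (UNIV :: 'g set)"
  obtains \<xi> :: "'g lie_alg" where "one_param \<xi> 1 = g"
proof -
  let ?P = "\<lambda>n::nat. product_topology (\<lambda>_. top_of_set (sphere 0 1 :: complex set)) {..<n}"
  obtain n and \<phi> :: "'g \<Rightarrow> nat \<Rightarrow> complex"
    where "homeomorphic_map euclidean (?P n) \<phi>"
      and hom: "\<And>g h i. i < n \<Longrightarrow> \<phi> (g + h) i = \<phi> g i * \<phi> h i"
    using assms unfolding is_torus_def by auto
  then obtain \<psi> where maps: "homeomorphic_maps euclidean (?P n) \<phi> \<psi>"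
    unfolding homeomorphic_map_maps by blast
  then have \<psi>: "continuous_map (?P n) euclidean \<psi>" and \<psi>\<phi>: "\<And>g. \<psi> (\<phi> g) = g"
    and \<phi>\<psi>: "\<And>x. x \<in> topspace (?P n) \<Longrightarrow> \<phi> (\<psi> x) = x"
    and \<phi>: "\<And>g. \<phi> g \<in> topspace (?P n)"
    by (auto simp: homeomorphic_maps_def continuous_map_def)
  define \<theta> where "\<theta> i = Arg (\<phi> g i)" for i
  define c where "c s = (\<lambda>i\<in>{..<n}. cis (s * \<theta> i))" for s :: real
  define \<gamma> where "\<gamma> s = \<psi> (c s)" for s
  have c_top: "c s \<in> topspace (?P n)" for s
    by (simp add: c_def)
  have "continuous_map euclidean (?P n) c"
    unfolding continuous_map_componentwise
  proof (intro conjI ballI)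
    show "c ` topspace euclidean \<subseteq> extensional {..<n}"
      by (auto simp: c_def)
    fix i assume i: "i \<in> {..<n}"
    have "continuous_on UNIV (\<lambda>s. cis (s * \<theta> i))"
      unfolding cis_conv_exp by (intro continuous_intros)
    then have "continuous_map euclidean (top_of_set (sphere 0 1)) (\<lambda>s. cis (s * \<theta> i))"
      by (auto simp: continuous_map_in_subtopology)
    then show "continuous_map euclidean (top_of_set (sphere 0 1)) (\<lambda>s. c s i)"
      using i by (simp add: c_def)
  qed
  from continuous_map_compose[OF this \<psi>] have cont: "continuous_on UNIV \<gamma>"
    by (simp add: \<gamma>_def[abs_def] o_def)
  have add: "\<gamma> (s + t) = \<gamma> s + \<gamma> t" for s t
  proof -
    have "\<phi> (\<gamma> s + \<gamma> t) = c (s + t)"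
    proof (rule PiE_ext)
      show "\<phi> (\<gamma> s + \<gamma> t) \<in> PiE {..<n} (\<lambda>_. sphere 0 1)"
        using \<phi>[of "\<gamma> s + \<gamma> t"] by simp
      show "c (s + t) \<in> PiE {..<n} (\<lambda>_. sphere 0 1)"
        using c_top[of "s + t"] by simp
      fix i assume "i \<in> {..<n}"
      then show "\<phi> (\<gamma> s + \<gamma> t) i = c (s + t) i"
        by (simp add: hom \<gamma>_def \<phi>\<psi>[OF c_top]) (simp add: c_def cis_mult algebra_simps)
    qed
    then show ?thesis
      using \<psi>\<phi> \<gamma>_def by metis
  qed
  have "c 1 = \<phi> g"
  proof (rule PiE_ext)
    show "c 1 \<in> PiE {..<n} (\<lambda>_. sphere 0 1)"
      using c_top[of 1] by simp
    show "\<phi> g \<in> PiE {..<n} (\<lambda>_. sphere 0 1)"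
      using \<phi>[of g] by simp
    fix i assume i: "i \<in> {..<n}"
    have "\<phi> g \<in> PiE {..<n} (\<lambda>_. sphere 0 1)"
      using \<phi>[of g] by simp
    from PiE_mem[OF this i] have norm: "norm (\<phi> g i) = 1"
      by simp
    then have "\<phi> g i \<noteq> 0"
      by force
    moreover have "sgn (\<phi> g i) = \<phi> g i"
      by (simp add: sgn_div_norm norm)
    ultimately show "c 1 i = \<phi> g i"
      using i by (simp add: c_def \<theta>_def cis_Arg)
  qed
  then have "\<gamma> 1 = g"
    by (simp add: \<gamma>_def \<psi>\<phi>)
  moreover have "one_param (Abs_lie_alg \<gamma>) = \<gamma>"
    using cont add by (simp add: Abs_lie_alg_inverse)
  ultimately show thesis
    using that by metis
qed

lemma isotropy_alg_eq_UNIV_iff: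
  fixes act :: "'g::topological_ab_group_add \<Rightarrow> 'x \<Rightarrow> 'x"
  assumes "is_torus (UNIV :: 'g set)" and "p \<in> topspace X"
  shows "isotropy_alg act p = UNIV \<longleftrightarrow> p \<in> fixed_points act X UNIV"
proof
  assume *: "isotropy_alg act p = UNIV"
  have "act g p = p" for g
  proof -
    obtain \<xi> :: "'g lie_alg" where "one_param \<xi> 1 = g"
      using torus_one_param[OF assms(1)] .
    moreover have "\<xi> \<in> isotropy_alg act p"
      using * by simp
    ultimately show ?thesis
      by (auto simp: isotropy_alg_def lie_of_def)
  qed
  then show "p \<in> fixed_points act X UNIV"
    using assms(2) by (simp add: fixed_points_def)
qed (auto simp: fixed_points_def isotropy_alg_def lie_of_def)

section \<open>Kernel and torsion, pointwise\<close>

text \<open>Zero in these algebras and in \<open>S(\<tt>\<^sup>*)\<close> is an extensional function.  The next two lemmas remove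
  this encoding once and for all, leaving conditions on the values \<open>A p \<xi>\<close> with \<open>\<xi> \<in> \<tt>\<^sub>p\<close>.\<close>

lemma a_kernel_restriction_map_iff:
  fixes act :: "'g::topological_ab_group_add \<Rightarrow> 'x \<Rightarrow> 'x"
  assumes "Y \<subseteq> topspace X"
  shows "A \<in> a_kernel (assignment_algebra act X) (assignment_algebra act (subtopology X Y))
            (restriction_map Y)
    \<longleftrightarrow> A \<in> assignments act X \<and> (\<forall>p\<in>Y. \<forall>\<xi>\<in>isotropy_alg act p. A p \<xi> = 0)"
proof -
  have Y: "topspace X \<inter> Y = Y"
    using assms by blast
  have "restrict A Y = (\<lambda>p\<in>Y. \<lambda>\<xi>\<in>isotropy_alg act p. 0)
    \<longleftrightarrow> (\<forall>p\<in>Y. \<forall>\<xi>\<in>isotropy_alg act p. A p \<xi> = 0)" if A: "A \<in> assignments act X"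
  proof
    assume eq: "restrict A Y = (\<lambda>p\<in>Y. \<lambda>\<xi>\<in>isotropy_alg act p. 0)"
    show "\<forall>p\<in>Y. \<forall>\<xi>\<in>isotropy_alg act p. A p \<xi> = 0"
    proof (intro ballI)
      fix p \<xi> assume "p \<in> Y" "\<xi> \<in> isotropy_alg act p"
      then show "A p \<xi> = 0"
        using fun_cong[OF fun_cong[OF eq], of p \<xi>] by simp
    qed
  next
    assume zero: "\<forall>p\<in>Y. \<forall>\<xi>\<in>isotropy_alg act p. A p \<xi> = 0"
    show "restrict A Y = (\<lambda>p\<in>Y. \<lambda>\<xi>\<in>isotropy_alg act p. 0)"
    proof (rule restrict_ext)
      fix p assume p: "p \<in> Y"
      then have "A p = (\<lambda>\<xi>\<in>isotropy_alg act p. A p \<xi>)"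
        using poly_funs_ext[OF assignments_poly[OF A]] assms by auto
      also have "\<dots> = (\<lambda>\<xi>\<in>isotropy_alg act p. 0)"
        using zero p by (intro restrict_ext) blast
      finally show "A p = (\<lambda>\<xi>\<in>isotropy_alg act p. 0)" .
    qed
  qed
  then show ?thesis
    by (auto simp: a_kernel_def kernel_def assignment_algebra_def restriction_map_def Y)
qed

lemma torsion_submodule_assignment_algebra_iff:
  fixes act :: "'g::topological_ab_group_add \<Rightarrow> 'x \<Rightarrow> 'x"
  shows "A \<in> torsion_submodule (poly_ring UNIV) (assignment_algebra act X)
    \<longleftrightarrow> A \<in> assignments act X \<and>
       (\<exists>f\<in>poly_funs UNIV. (\<exists>\<xi>. f \<xi> \<noteq> 0) \<and>
          (\<forall>p\<in>topspace X. \<forall>\<xi>\<in>isotropy_alg act p. f \<xi> * A p \<xi> = 0))"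
proof -
  have "(\<lambda>p\<in>topspace X. \<lambda>\<xi>\<in>isotropy_alg act p. f \<xi> * A p \<xi>) =
      (\<lambda>p\<in>topspace X. \<lambda>\<xi>\<in>isotropy_alg act p. 0)
    \<longleftrightarrow> (\<forall>p\<in>topspace X. \<forall>\<xi>\<in>isotropy_alg act p. f \<xi> * A p \<xi> = 0)" (is "?L = ?R \<longleftrightarrow> _") for f
  proof
    assume eq: "?L = ?R"
    show "\<forall>p\<in>topspace X. \<forall>\<xi>\<in>isotropy_alg act p. f \<xi> * A p \<xi> = 0"
    proof (intro ballI)
      fix p \<xi> assume "p \<in> topspace X" "\<xi> \<in> isotropy_alg act p"
      then show "f \<xi> * A p \<xi> = 0"
        using fun_cong[OF fun_cong[OF eq], of p \<xi>] by simp
    qed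
  qed (intro restrict_ext, blast)
  moreover have "f \<noteq> (\<lambda>\<xi>\<in>UNIV. 0) \<longleftrightarrow> (\<exists>\<xi>. f \<xi> \<noteq> 0)" for f :: "'g lie_alg \<Rightarrow> real"
    by (auto simp: fun_eq_iff)
  ultimately show ?thesis
    by (simp add: torsion_submodule_def poly_ring_def assignment_algebra_def)
qed

theorem proposition4p1:
  fixes X :: "'x topology"
    and act :: "'g::topological_ab_group_add \<Rightarrow> 'x \<Rightarrow> 'x"
  assumes "is_torus (UNIV :: 'g set)"
    and "connected_space X"
    and "continuous_action act X"
    and "finite {isotropy_alg act p | p. p \<in> topspace X}"
  shows "a_kernel (assignment_algebra act X)
           (assignment_algebra act (subtopology X (fixed_points act X UNIV)))
           (restriction_map (fixed_points act X UNIV))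
         = torsion_submodule (poly_ring (UNIV :: 'g lie_alg set)) (assignment_algebra act X)"
    (is "?K = ?T")
proof -
  let ?Y = "fixed_points act X UNIV"
  have Y: "?Y \<subseteq> topspace X"
    by (auto simp: fixed_points_def)
  have kernel: "A \<in> ?K \<longleftrightarrow>
      A \<in> assignments act X \<and> (\<forall>p\<in>?Y. \<forall>\<xi>\<in>isotropy_alg act p. A p \<xi> = 0)" for A
    using Y by (rule a_kernel_restriction_map_iff)
  show ?thesis
  proof (intro equalityI subsetI)
    fix A assume "A \<in> ?K"
    then have A: "A \<in> assignments act X"
      and zero: "\<And>p \<xi>. p \<in> ?Y \<Longrightarrow> \<xi> \<in> isotropy_alg act p \<Longrightarrow> A p \<xi> = 0"
      unfolding kernel by blast+
    let ?F = "{isotropy_alg act p | p. p \<in> topspace X} - {UNIV}"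
    have "\<exists>f\<in>poly_funs UNIV. (\<exists>\<xi>. f \<xi> \<noteq> 0) \<and> (\<forall>W\<in>?F. \<forall>\<xi>\<in>W. f \<xi> = 0)"
      using assms(4) subspace_isotropy_alg[OF assms(3)]
      by (intro finite_proper_subspaces_annihilated) auto
    then obtain f where f: "f \<in> poly_funs UNIV" "\<exists>\<xi>. f \<xi> \<noteq> 0"
      and annih: "\<And>W \<xi>. W \<in> ?F \<Longrightarrow> \<xi> \<in> W \<Longrightarrow> f \<xi> = 0"
      by blast
    have "f \<xi> * A p \<xi> = 0" if p: "p \<in> topspace X" and \<xi>: "\<xi> \<in> isotropy_alg act p" for p \<xi>
    proof (cases "p \<in> ?Y")
      case True
      then show ?thesis
        using zero \<xi> by simp
    next
      case False
      then have "isotropy_alg act p \<in> ?F"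
        using isotropy_alg_eq_UNIV_iff[OF assms(1) p] p by blast
      then show ?thesis
        using annih \<xi> by simp
    qed
    then show "A \<in> ?T"
      unfolding torsion_submodule_assignment_algebra_iff using A f by blast
  next
    fix A assume "A \<in> ?T"
    then obtain f x where A: "A \<in> assignments act X" and f: "f \<in> poly_funs UNIV" "f x \<noteq> 0"
      and fA: "\<And>p \<xi>. p \<in> topspace X \<Longrightarrow> \<xi> \<in> isotropy_alg act p \<Longrightarrow> f \<xi> * A p \<xi> = 0"
      unfolding torsion_submodule_assignment_algebra_iff by blast
    have "A p \<xi> = 0" if p: "p \<in> ?Y" for p \<xi>
    proof (rule ccontr)
      assume "A p \<xi> \<noteq> 0"
      have pX: "p \<in> topspace X"
        using p Y by blast
      have t: "isotropy_alg act p = UNIV"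
        using isotropy_alg_eq_UNIV_iff[OF assms(1) pX] p by blast
      have "A p \<in> poly_funs UNIV"
        using assignments_poly[OF A pX] t by simp
      from poly_funs_no_zero_divisors[OF f(1) UNIV_I f(2) this UNIV_I \<open>A p \<xi> \<noteq> 0\<close> subspace_UNIV]
      obtain z where "f z * A p z \<noteq> 0"
        by blast
      then show False
        using fA[OF pX, of z] t by simp
    qed
    then show "A \<in> ?K"
      unfolding kernel using A by blast
  qed
qed

end
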